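(* For every integer $n\ge 1$, the clique complex $K_n$ of the partition graph $G_n$ has the homotopy type of a CW-complex of dimension at most $2$.
   Context: A partition of a positive integer $n$ is a weakly decreasing sequence $\lambda=(\lambda_1\ge\cdots\ge\lambda_\ell>0)$ of positive integers with sum $n$; it is identified with its Ferrers diagram, the left-justified array with $\lambda_i$ cells in row $i$. The partition graph $G_n$ is the simple graph whose vertices are all partitions of $n$; two distinct partitions are adjacent if one can be obtained from the other by removing one cell from a row of the Ferrers diagram, adding it to another row (possibly a new row, i.e. a row of length $0$), and then reordering the row lengths into weakly decreasing order (discarding zeros). $K_n:=\mathrm{Cl}(G_n)$ is the clique complex of $G_n$: the simplicial complex whose simplices are the finite nonempty cliques of $G_n$. *)

theory Defs
  imports "HOL-Analysis.Analysis"
begin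

definition partitions :: "nat \<Rightarrow> nat list set" where
  "partitions n = {xs. sorted_wrt (\<ge>) xs \<and> (\<forall>x\<in>set xs. 0 < x) \<and> sum_list xs = n}"

text \<open>One cell is moved from row \<open>i\<close> to row \<open>j\<close>, rows being numbered from 0. The appended 0 is the
  row of length 0, so \<open>j = length xs\<close> opens a new row.\<close>

definition move_cell :: "nat list \<Rightarrow> nat \<Rightarrow> nat \<Rightarrow> nat list" where
  "move_cell xs i j =
     (let ys = xs @ [0]
      in rev (sort (filter (\<lambda>r. 0 < r) (ys[i := ys ! i - 1, j := ys ! j + 1]))))"

definition cell_move :: "nat list \<Rightarrow> nat list \<Rightarrow> bool" where
  "cell_move xs ys \<longleftrightarrow> (\<exists>i j. i < length xs \<and> j \<le> length xs \<and> i \<noteq> j \<and> ys = move_cell xs i j)"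

definition partition_adj :: "nat list \<Rightarrow> nat list \<Rightarrow> bool" where
  "partition_adj xs ys \<longleftrightarrow> xs \<noteq> ys \<and> (cell_move xs ys \<or> cell_move ys xs)"

definition clique_complex :: "'v set \<Rightarrow> ('v \<Rightarrow> 'v \<Rightarrow> bool) \<Rightarrow> 'v set set" where
  "clique_complex V adj =
     {S. S \<noteq> {} \<and> finite S \<and> S \<subseteq> V \<and> (\<forall>x\<in>S. \<forall>y\<in>S. x \<noteq> y \<longrightarrow> adj x y)}"

definition partition_complex :: "nat \<Rightarrow> nat list set set" where
  "partition_complex n = clique_complex (partitions n) partition_adj"

text \<open>Points are given by barycentric coordinates. The subspace topology of the product topology is
  the usual (weak) topology of the realization when the complex is finite, as
  \<^term>\<open>partition_complex n\<close> is; for infinite complexes it would in general be coarser.\<close>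

definition geometric_realization :: "'v set set \<Rightarrow> ('v \<Rightarrow> real) topology" where
  "geometric_realization K =
     subtopology (powertop_real UNIV)
       {x. (\<forall>v. 0 \<le> x v) \<and> {v. x v \<noteq> 0} \<in> K \<and> (\<Sum>v | x v \<noteq> 0. x v) = 1}"

definition disc :: "nat \<Rightarrow> (nat \<Rightarrow> real) topology" where
  "disc k = subtopology (Euclidean_space k) {x. (\<Sum>i<k. x i ^ 2) \<le> 1}"

definition open_disc :: "nat \<Rightarrow> (nat \<Rightarrow> real) set" where
  "open_disc k = {x \<in> topspace (disc k). (\<Sum>i<k. x i ^ 2) < 1}"

definition disc_boundary :: "nat \<Rightarrow> (nat \<Rightarrow> real) set" where
  "disc_boundary k = {x \<in> topspace (disc k). (\<Sum>i<k. x i ^ 2) = 1}"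

text \<open>Whitehead's intrinsic definition: \<open>E\<close> is the set of open cells, \<open>dm e\<close> the dimension of the
  cell \<open>e\<close> and \<open>\<Phi> e\<close> its characteristic map. The condition on the boundary contains closure finiteness
  (the closure of \<open>e\<close> is the image of the closed disc under \<open>\<Phi> e\<close>); the last one is the weak
  topology.\<close>

definition CW_structure ::
  "'a topology \<Rightarrow> 'a set set \<Rightarrow> ('a set \<Rightarrow> nat) \<Rightarrow> ('a set \<Rightarrow> (nat \<Rightarrow> real) \<Rightarrow> 'a) \<Rightarrow> bool" where
  "CW_structure X E dm \<Phi> \<longleftrightarrow>
     Hausdorff_space X \<and>
     \<Union>E = topspace X \<and> disjoint E \<and>
     (\<forall>e\<in>E. continuous_map (disc (dm e)) X (\<Phi> e) \<and>
            homeomorphic_map (subtopology (disc (dm e)) (open_disc (dm e))) (subtopology X e) (\<Phi> e)) \<and>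
     (\<forall>e\<in>E. \<exists>F. finite F \<and> F \<subseteq> E \<and> (\<forall>f\<in>F. dm f < dm e) \<and> \<Phi> e ` disc_boundary (dm e) \<subseteq> \<Union>F) \<and>
     (\<forall>A. A \<subseteq> topspace X \<longrightarrow>
        (closedin X A \<longleftrightarrow> (\<forall>e\<in>E. closedin (subtopology X (X closure_of e)) (A \<inter> X closure_of e))))"

definition CW_complex_dim_le :: "nat \<Rightarrow> 'a topology \<Rightarrow> bool" where
  "CW_complex_dim_le d X \<longleftrightarrow> (\<exists>E dm \<Phi>. CW_structure X E dm \<Phi> \<and> (\<forall>e\<in>E. dm e \<le> d))"

text \<open>HOL cannot quantify existentially over the type of points of the CW-complex, so the type
  \<^typ>\<open>nat \<Rightarrow> real\<close> is fixed. For a space \<open>X\<close> with the homotopy type of a finite complex this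
  is no restriction: if \<open>X\<close> is homotopy equivalent to a CW-complex of dimension at most \<open>d\<close>, then it is
  homotopy equivalent to a countable subcomplex of it, which has at most continuum many
  points and can be carried over to \<^typ>\<open>nat \<Rightarrow> real\<close>.\<close>

definition has_homotopy_type_of_CW_dim_le :: "'a topology \<Rightarrow> nat \<Rightarrow> bool" where
  "has_homotopy_type_of_CW_dim_le X d \<longleftrightarrow>
     (\<exists>Y :: (nat \<Rightarrow> real) topology. CW_complex_dim_le d Y \<and> X homotopy_equivalent_space Y)"

end

theory Submission
  imports Defs
begin

text \<open>Encode a partition by the multiset of the column indices of its cells. Two partitions are
  adjacent iff these multisets differ by the exchange of one element, as in a Johnson graph. The three
  multisets of a triangle are therefore \<open>N + p, N + q, N + r\<close> or \<open>M - p, M - q, M - r\<close>, and any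
  vertex adjacent to all three has the same form with the same \<open>N\<close> or \<open>M\<close>. Hence two simplices of
  \<open>K\<^sub>n\<close> with three common vertices span a simplex, and every simplex with at least three vertices
  lies in exactly one facet. In each facet choose an apex and collapse the facet, away from the other
  facets, onto the cone from the apex over the edges of the opposite face. What remains is a
  subcomplex of dimension at most 2 which is a deformation retract.\<close>

section \<open>Geometric realizations\<close>

text \<open>Distinct facets may share an edge, so no edge may be moved. This is why the collapse
  stops in dimension 2: inside a facet, the cone from the apex over the edges of the opposite face
  is contractible and still contains every edge of the facet. Since everything shared by two facets
  stays fixed, the collapses of different facets are independent of each other. Instead of being
  pasted together from maps on single facets, the retraction \<open>push\<close> is one formula in
  the barycentric coordinates, defined on the whole function space. Its continuity is then
  immediate, and since a point and its image lie in a common simplex, a straight-line homotopy joins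
  it to the identity.\<close>

definition supp :: "('v \<Rightarrow> real) \<Rightarrow> 'v set" where
  "supp x = {v. x v \<noteq> 0}"

definition realization_points :: "'v set set \<Rightarrow> ('v \<Rightarrow> real) set" where
  "realization_points K = {x. (\<forall>v. 0 \<le> x v) \<and> supp x \<in> K \<and> sum x (supp x) = 1}"

lemma geometric_realization_eq:
  "geometric_realization K = top_of_set (realization_points K)"
  by (simp add: geometric_realization_def realization_points_def supp_def euclidean_product_topology)

lemma sum_supp: "finite A \<Longrightarrow> supp x \<subseteq> A \<Longrightarrow> sum x (supp x) = sum x A"
  by (rule sum.mono_neutral_left) (auto simp: supp_def)

locale finite_complex =
  fixes K :: "'v set set"
  assumes finite_complex: "finite K"
    and finite_simplex: "\<sigma> \<in> K \<Longrightarrow> finite \<sigma>"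
    and simplex_nonempty: "\<sigma> \<in> K \<Longrightarrow> \<sigma> \<noteq> {}"
    and face_closed: "\<sigma> \<in> K \<Longrightarrow> \<tau> \<subseteq> \<sigma> \<Longrightarrow> \<tau> \<noteq> {} \<Longrightarrow> \<tau> \<in> K"
begin

lemma realization_pointsI:
  assumes "\<kappa> \<in> K" "\<And>v. 0 \<le> x v" "supp x \<subseteq> \<kappa>" "sum x \<kappa> = 1"
  shows "x \<in> realization_points K"
proof -
  have "sum x (supp x) = 1"
    using assms sum_supp[OF finite_simplex] by metis
  moreover from this have "supp x \<noteq> {}"
    by auto
  ultimately show ?thesis
    using assms face_closed unfolding realization_points_def by blast
qed

text \<open>Both ends lie in the common simplex \<open>\<kappa>\<close>, which is convex. This keeps
  the homotopy between \<open>push\<close> and the identity inside the realization.\<close>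

lemma segment_in_realization:
  assumes "\<kappa> \<in> K" "x \<in> realization_points K" "y \<in> realization_points K"
    and "supp x \<subseteq> \<kappa>" "supp y \<subseteq> \<kappa>" "0 \<le> t" "t \<le> 1"
  shows "(\<lambda>v. (1 - t) * x v + t * y v) \<in> realization_points K"
proof (rule realization_pointsI[OF \<open>\<kappa> \<in> K\<close>])
  have "sum x \<kappa> = 1" "sum y \<kappa> = 1"
    using assms sum_supp[OF finite_simplex] unfolding realization_points_def by (metis (mono_tags, lifting) mem_Collect_eq)+
  then show "(\<Sum>v\<in>\<kappa>. (1 - t) * x v + t * y v) = 1"
    by (simp add: sum.distrib flip: sum_distrib_left)
  show "supp (\<lambda>v. (1 - t) * x v + t * y v) \<subseteq> \<kappa>"
    using assms(4,5) by (fastforce simp: supp_def)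
qed (use assms in \<open>auto simp: realization_points_def\<close>)

end

lemma three_le_card_iff:
  assumes "finite A"
  shows "3 \<le> card A \<longleftrightarrow> (\<exists>u\<in>A. \<exists>v\<in>A. \<exists>w\<in>A. u \<noteq> v \<and> u \<noteq> w \<and> v \<noteq> w)"
proof
  assume "3 \<le> card A"
  then obtain B where "B \<subseteq> A" "card B = 3"
    by (meson obtain_subset_with_card_n)
  then show "\<exists>u\<in>A. \<exists>v\<in>A. \<exists>w\<in>A. u \<noteq> v \<and> u \<noteq> w \<and> v \<noteq> w"
    by (auto simp: card_3_iff)
next
  assume "\<exists>u\<in>A. \<exists>v\<in>A. \<exists>w\<in>A. u \<noteq> v \<and> u \<noteq> w \<and> v \<noteq> w"
  then obtain u v w where "{u, v, w} \<subseteq> A" "card {u, v, w} = 3"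
    by auto
  then show "3 \<le> card A"
    using card_mono[OF assms] by metis
qed

section \<open>Collapsing facets\<close>

text \<open>All that the collapse needs to know about partitions: by maximality, distinct facets can
  share at most two vertices.\<close>

locale triangle_rigid_complex = finite_complex +
  assumes glue: "\<sigma> \<in> K \<Longrightarrow> \<tau> \<in> K \<Longrightarrow> 3 \<le> card (\<sigma> \<inter> \<tau>) \<Longrightarrow> \<sigma> \<union> \<tau> \<in> K"
begin

definition facets :: "'a set set" where
  "facets = {\<sigma> \<in> K. 3 \<le> card \<sigma> \<and> (\<forall>\<tau>\<in>K. \<sigma> \<subseteq> \<tau> \<longrightarrow> \<tau> = \<sigma>)}"

text \<open>Any vertex will do. The collapses fix all edges, so the choices in different facets need
  not be compatible.\<close>

definition apex :: "'a set \<Rightarrow> 'a" where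
  "apex \<sigma> = (SOME v. v \<in> \<sigma>)"

text \<open>Outside the apex at most two vertices of each facet: the edges of the opposite face and the
  triangles through the apex.\<close>

definition core :: "'a set set" where
  "core = {\<tau> \<in> K. \<forall>\<sigma>\<in>facets. card (\<tau> \<inter> \<sigma> - {apex \<sigma>}) \<le> 2}"

text \<open>A continuous function that dominates the third largest coordinate of \<open>x\<close> on the face opposite to
  the apex, and vanishes when that coordinate does. Subtracting it therefore leaves at most two
  nonzero coordinates there.\<close>

definition excess :: "'a set \<Rightarrow> ('a \<Rightarrow> real) \<Rightarrow> real" where
  "excess \<sigma> x = (\<Sum>u\<in>\<sigma> - {apex \<sigma>}. \<Sum>v\<in>\<sigma> - {apex \<sigma>, u}. \<Sum>w\<in>\<sigma> - {apex \<sigma>, u, v}.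
     min (x u) (min (x v) (x w)))"

text \<open>Base coordinates drop by the excess, but not below zero; the apex receives what they
  lose, which preserves the coordinate sum.\<close>

definition shift :: "'a set \<Rightarrow> ('a \<Rightarrow> real) \<Rightarrow> 'a \<Rightarrow> real" where
  "shift \<sigma> x v = (if v = apex \<sigma> then \<Sum>w\<in>\<sigma> - {apex \<sigma>}. min (x w) (excess \<sigma> x)
     else if v \<in> \<sigma> then - min (x v) (excess \<sigma> x) else 0)"

text \<open>Summing over all facets avoids pasting. At each point of the realization at most one
  summand is nonzero.\<close>

definition push :: "('a \<Rightarrow> real) \<Rightarrow> 'a \<Rightarrow> real" where
  "push x v = x v + (\<Sum>\<sigma>\<in>facets. shift \<sigma> x v)"

section \<open>Facets and the core\<close>

lemma facetsD: "\<sigma> \<in> facets \<Longrightarrow> \<sigma> \<in> K \<and> finite \<sigma> \<and> apex \<sigma> \<in> \<sigma>"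
  using finite_simplex[of \<sigma>] simplex_nonempty[of \<sigma>] by (simp add: facets_def apex_def some_in_eq)

lemma finite_facets: "finite facets"
  using finite_complex unfolding facets_def by simp

text \<open>By \<open>glue\<close> the union is a simplex, and it contains the maximal simplex
  \<open>\<sigma>\<close>.\<close>

lemma facet_absorbs:
  assumes "\<sigma> \<in> facets" "\<tau> \<in> K" "3 \<le> card (\<tau> \<inter> \<sigma>)"
  shows "\<tau> \<subseteq> \<sigma>"
  using assms glue[of \<sigma> \<tau>] unfolding facets_def by (auto simp: Int_commute)

lemma facet_above:
  assumes "\<tau> \<in> K" "3 \<le> card \<tau>"
  obtains \<sigma> where "\<sigma> \<in> facets" "\<tau> \<subseteq> \<sigma>"
proof -
  obtain \<sigma> where \<sigma>: "\<sigma> \<in> K" "\<tau> \<subseteq> \<sigma>" "\<forall>\<rho>\<in>K. \<sigma> \<subseteq> \<rho> \<longrightarrow> \<sigma> = \<rho>"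
    using finite_has_maximal2[OF finite_complex \<open>\<tau> \<in> K\<close>] by metis
  moreover have "3 \<le> card \<sigma>"
    using card_mono[OF finite_simplex[OF \<open>\<sigma> \<in> K\<close>] \<open>\<tau> \<subseteq> \<sigma>\<close>] assms by simp
  ultimately have "\<sigma> \<in> facets"
    unfolding facets_def by blast
  then show ?thesis
    using that \<open>\<tau> \<subseteq> \<sigma>\<close> by blast
qed

text \<open>A larger simplex would lie in a facet, where the core allows only two vertices besides
  the apex.\<close>

lemma card_core:
  assumes "\<tau> \<in> core" shows "card \<tau> \<le> 3"
proof (rule ccontr)
  assume "\<not> card \<tau> \<le> 3"
  moreover have "\<tau> \<in> K"
    using assms by (simp add: core_def)
  ultimately obtain \<sigma> where \<sigma>: "\<sigma> \<in> facets" "\<tau> \<subseteq> \<sigma>"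
    using facet_above[of \<tau>] by auto
  then have "card \<tau> - 1 \<le> card (\<tau> \<inter> \<sigma> - {apex \<sigma>})"
    by (simp add: Int_absorb2 diff_card_le_card_Diff card_Diff_singleton_if)
  with \<sigma> assms \<open>\<not> card \<tau> \<le> 3\<close> show False
    by (fastforce simp: core_def)
qed

lemma finite_complex_core: "finite_complex core"
proof
  fix \<sigma> \<tau> assume *: "\<sigma> \<in> core" "\<tau> \<subseteq> \<sigma>" "\<tau> \<noteq> {}"
  have "card (\<tau> \<inter> \<rho> - {apex \<rho>}) \<le> 2" if "\<rho> \<in> facets" for \<rho>
  proof -
    have "card (\<tau> \<inter> \<rho> - {apex \<rho>}) \<le> card (\<sigma> \<inter> \<rho> - {apex \<rho>})"
      using * finite_simplex by (intro card_mono) (auto simp: core_def)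
    then show ?thesis
      using * that by (fastforce simp: core_def)
  qed
  moreover have "\<tau> \<in> K"
    using * face_closed[of \<sigma> \<tau>] by (simp add: core_def)
  ultimately show "\<tau> \<in> core"
    by (simp add: core_def)
qed (use finite_complex finite_simplex simplex_nonempty in \<open>auto simp: core_def\<close>)

section \<open>The deformation retraction onto the core\<close>

lemma excess_nonneg: "(\<And>v. 0 \<le> x v) \<Longrightarrow> 0 \<le> excess \<sigma> x"
  unfolding excess_def by (intro sum_nonneg) simp

text \<open>The minimum is a single summand of the triple sum, whose terms are all
  nonnegative.\<close>

lemma excess_ge_third:
  assumes nonneg: "\<And>v. 0 \<le> x v" and fin: "finite \<sigma>"
    and "{u, v, w} \<subseteq> \<sigma> - {apex \<sigma>}" "u \<noteq> v" "u \<noteq> w" "v \<noteq> w"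
  shows "min (x u) (min (x v) (x w)) \<le> excess \<sigma> x"
proof -
  define f where "f u v w = min (x u) (min (x v) (x w))" for u v w
  have f: "0 \<le> f u v w" for u v w
    using nonneg by (simp add: f_def)
  have "f u v w \<le> sum (f u v) (\<sigma> - {apex \<sigma>, u, v})"
    using assms f by (intro member_le_sum) auto
  also have "\<dots> \<le> (\<Sum>v\<in>\<sigma> - {apex \<sigma>, u}. sum (f u v) (\<sigma> - {apex \<sigma>, u, v}))"
    by (rule member_le_sum) (use assms in \<open>auto intro!: sum_nonneg f\<close>)
  also have "\<dots> \<le> (\<Sum>u\<in>\<sigma> - {apex \<sigma>}. \<Sum>v\<in>\<sigma> - {apex \<sigma>, u}. sum (f u v) (\<sigma> - {apex \<sigma>, u, v}))"
    by (rule member_le_sum) (use assms in \<open>auto intro!: sum_nonneg f\<close>)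
  finally show ?thesis
    by (simp add: f_def excess_def)
qed

text \<open>A summand is positive just when its three vertices lie in the support. So the excess
  vanishes exactly where the condition that \<open>\<sigma>\<close> imposes on \<open>core\<close>
  holds.\<close>

lemma excess_pos_iff:
  assumes "\<And>v. 0 \<le> x v" "finite \<sigma>"
  shows "0 < excess \<sigma> x \<longleftrightarrow> 3 \<le> card (supp x \<inter> \<sigma> - {apex \<sigma>})"
proof
  assume pos: "0 < excess \<sigma> x"
  show "3 \<le> card (supp x \<inter> \<sigma> - {apex \<sigma>})"
  proof (rule ccontr)
    assume few: "\<not> ?thesis"
    have "excess \<sigma> x \<le> 0"
      unfolding excess_def
    proof (rule sum_nonpos)+
      fix u v w assume *: "u \<in> \<sigma> - {apex \<sigma>}" "v \<in> \<sigma> - {apex \<sigma>, u}" "w \<in> \<sigma> - {apex \<sigma>, u, v}"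
      have "\<not> {u, v, w} \<subseteq> supp x"
      proof
        assume "{u, v, w} \<subseteq> supp x"
        with * have "card {u, v, w} \<le> card (supp x \<inter> \<sigma> - {apex \<sigma>})"
          using assms(2) by (intro card_mono) auto
        moreover have "card {u, v, w} = 3"
          using * by auto
        ultimately show False
          using few by simp
      qed
      then show "min (x u) (min (x v) (x w)) \<le> 0"
        by (auto simp: supp_def)
    qed
    with pos show False by simp
  qed
next
  assume "3 \<le> card (supp x \<inter> \<sigma> - {apex \<sigma>})"
  then obtain u v w where *: "{u, v, w} \<subseteq> supp x \<inter> \<sigma> - {apex \<sigma>}" "u \<noteq> v" "u \<noteq> w" "v \<noteq> w"
    using assms(2) by (subst (asm) three_le_card_iff) auto
  then have "0 < min (x u) (min (x v) (x w))"
    using assms(1) by (auto simp: supp_def less_le)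
  also have "\<dots> \<le> excess \<sigma> x"
    using * assms by (intro excess_ge_third) auto
  finally show "0 < excess \<sigma> x" .
qed

lemma shift_0: "(\<And>v. 0 \<le> x v) \<Longrightarrow> excess \<sigma> x = 0 \<Longrightarrow> shift \<sigma> x v = 0"
  by (simp add: shift_def min_absorb2)

lemma push_eq_self:
  assumes "x \<in> realization_points core"
  shows "push x = x"
proof -
  have "excess \<sigma> x = 0" if "\<sigma> \<in> facets" for \<sigma>
    using assms that excess_pos_iff[of x \<sigma>] excess_nonneg[of x \<sigma>] facetsD[OF that]
    by (fastforce simp: realization_points_def core_def)
  then show ?thesis
    using assms by (auto simp: push_def fun_eq_iff realization_points_def shift_0)
qed

text \<open>A facet with positive excess contains all of \<open>supp x\<close>. Two such facets
  share at least three vertices and coincide, so only one term of the sum in \<open>push\<close>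
  survives.\<close>

lemma push_outside_core:
  assumes x: "x \<in> realization_points K" "x \<notin> realization_points core"
  obtains \<sigma> where "\<sigma> \<in> facets" "supp x \<subseteq> \<sigma>" "\<And>v. push x v = x v + shift \<sigma> x v"
proof -
  have nonneg: "\<And>v. 0 \<le> x v" and "supp x \<in> K" "supp x \<notin> core"
    using x by (auto simp: realization_points_def core_def)
  then obtain \<sigma> where \<sigma>: "\<sigma> \<in> facets" "3 \<le> card (supp x \<inter> \<sigma> - {apex \<sigma>})"
    by (fastforce simp: core_def)
  have big: "supp x \<subseteq> \<rho> \<and> 3 \<le> card (supp x)" if "\<rho> \<in> facets" "3 \<le> card (supp x \<inter> \<rho> - {apex \<rho>})" for \<rho>
  proof -
    have "3 \<le> card (supp x \<inter> \<rho>)"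
      using that facetsD[OF that(1)] card_mono[OF _ Diff_subset, of "supp x \<inter> \<rho>" "{apex \<rho>}"] by auto
    moreover from this have "3 \<le> card (supp x)"
      using card_mono[OF finite_simplex[OF \<open>supp x \<in> K\<close>], of "supp x \<inter> \<rho>"] by auto
    ultimately show ?thesis
      using facet_absorbs that \<open>supp x \<in> K\<close> by blast
  qed
  have "shift \<rho> x v = 0" if "\<rho> \<in> facets - {\<sigma>}" for \<rho> v
  proof -
    have "\<not> 3 \<le> card (supp x \<inter> \<rho> - {apex \<rho>})"
    proof
      assume "3 \<le> card (supp x \<inter> \<rho> - {apex \<rho>})"
      then have "supp x \<subseteq> \<rho> \<inter> \<sigma>" "3 \<le> card (supp x)"
        using big that \<sigma> by auto
      then have "3 \<le> card (\<rho> \<inter> \<sigma>)"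
        using card_mono[of "\<rho> \<inter> \<sigma>" "supp x"] facetsD[OF \<sigma>(1)] by auto
      then have "\<rho> \<subseteq> \<sigma>" "\<sigma> \<subseteq> \<rho>"
        using facet_absorbs[of \<sigma> \<rho>] facet_absorbs[of \<rho> \<sigma>] \<sigma>(1) that facetsD by (auto simp: Int_commute)
      with that show False by auto
    qed
    then have "excess \<rho> x = 0"
      using excess_pos_iff[of x \<rho>] excess_nonneg[of x \<rho>] nonneg facetsD[of \<rho>] that by auto
    then show ?thesis
      by (simp add: shift_0 nonneg)
  qed
  then have "push x v = x v + shift \<sigma> x v" for v
    unfolding push_def by (subst sum.remove[OF finite_facets \<sigma>(1)]) simp
  with that big \<sigma> show ?thesis by blast
qed

lemma push_in_core:
  assumes x: "x \<in> realization_points K"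
  shows "push x \<in> realization_points core \<and> (\<exists>\<kappa>\<in>K. supp x \<subseteq> \<kappa> \<and> supp (push x) \<subseteq> \<kappa>)"
proof (cases "x \<in> realization_points core")
  case True
  then show ?thesis
    using x by (auto simp: push_eq_self realization_points_def)
next
  case False
  then obtain \<sigma> where \<sigma>: "\<sigma> \<in> facets" "supp x \<subseteq> \<sigma>" and push: "\<And>v. push x v = x v + shift \<sigma> x v"
    using push_outside_core x by metis
  note \<sigma>' = facetsD[OF \<sigma>(1)]
  have nonneg: "\<And>v. 0 \<le> x v"
    using x by (auto simp: realization_points_def)
  let ?A = "\<sigma> - {apex \<sigma>}"
  have e: "0 \<le> excess \<sigma> x"
    using nonneg by (rule excess_nonneg)
  have base: "push x v = x v - min (x v) (excess \<sigma> x)" if "v \<in> ?A" for v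
    using that by (simp add: push shift_def)
  have top: "push x (apex \<sigma>) = x (apex \<sigma>) + (\<Sum>w\<in>?A. min (x w) (excess \<sigma> x))"
    by (simp add: push shift_def)
  have outside: "push x v = 0" if "v \<notin> \<sigma>" for v
    using that \<sigma> \<sigma>' by (auto simp: push shift_def supp_def)
  have "supp (push x) \<subseteq> \<sigma>"
    using outside by (auto simp: supp_def)
  have "sum (push x) \<sigma> = push x (apex \<sigma>) + sum (push x) ?A"
    using \<sigma>' by (simp add: sum.remove[of \<sigma> "apex \<sigma>"])
  also have "\<dots> = x (apex \<sigma>) + sum x ?A"
    by (simp add: top base sum_subtractf)
  also have "\<dots> = sum x \<sigma>"
    using \<sigma>' by (simp add: sum.remove[of \<sigma> "apex \<sigma>"])
  also have "\<dots> = 1"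
    using sum_supp[of \<sigma> x] \<sigma> \<sigma>' x by (simp add: realization_points_def)
  finally have sum: "sum (push x) \<sigma> = 1" .
  have "0 \<le> push x v" for v
    using nonneg e by (cases "v = apex \<sigma>"; cases "v \<in> \<sigma>") (simp_all add: top base outside sum_nonneg)
  then have "push x \<in> realization_points K"
    using sum \<sigma>' \<open>supp (push x) \<subseteq> \<sigma>\<close> by (intro realization_pointsI) auto
  moreover have "card (supp (push x) \<inter> \<rho> - {apex \<rho>}) \<le> 2" if "\<rho> \<in> facets" for \<rho>
  proof (cases "\<rho> = \<sigma>")
    case True
    show ?thesis
    proof (rule ccontr)
      assume "\<not> ?thesis"
      then have "3 \<le> card (supp (push x) \<inter> \<sigma> - {apex \<sigma>})"
        using True by simp
      then obtain u v w where *: "{u, v, w} \<subseteq> supp (push x) \<inter> \<sigma> - {apex \<sigma>}" "u \<noteq> v" "u \<noteq> w" "v \<noteq> w"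
        using \<sigma>' by (subst (asm) three_le_card_iff) auto
      then have "min (x u) (min (x v) (x w)) \<le> excess \<sigma> x"
        using \<sigma>' nonneg by (intro excess_ge_third) auto
      \<comment> \<open>Coordinates that survive the truncation exceed the excess, but the smallest
        of the three is at most the excess.\<close>
      with * show False
        by (auto simp: supp_def base min_def split: if_splits)
    qed
  next
    case False
    \<comment> \<open>For another facet the bound is automatic, because it shares at most two
      vertices with \<open>\<sigma>\<close>.\<close>
    have "card (supp (push x) \<inter> \<rho> - {apex \<rho>}) \<le> card (\<sigma> \<inter> \<rho>)"
      using \<sigma>' \<open>supp (push x) \<subseteq> \<sigma>\<close> by (intro card_mono) auto
    also have "\<dots> \<le> 2"
    proof (rule ccontr)
      assume "\<not> card (\<sigma> \<inter> \<rho>) \<le> 2"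
      then have "\<sigma> \<subseteq> \<rho>" "\<rho> \<subseteq> \<sigma>"
        using facet_absorbs[OF that, of \<sigma>] facet_absorbs[OF \<sigma>(1), of \<rho>] \<sigma>' facetsD[OF that]
        by (auto simp: Int_commute)
      with False show False by auto
    qed
    finally show ?thesis .
  qed
  ultimately have "push x \<in> realization_points core"
    by (auto simp: realization_points_def core_def)
  with \<sigma> \<sigma>' \<open>supp (push x) \<subseteq> \<sigma>\<close> show ?thesis
    by blast
qed

lemma continuous_on_push: "continuous_on UNIV push"
proof -
  have e: "continuous_on UNIV (excess \<sigma>)" for \<sigma>
    unfolding excess_def by (intro continuous_intros continuous_on_product_coordinates)
  have "continuous_on UNIV (\<lambda>x. shift \<sigma> x v)" for \<sigma> v
    unfolding shift_def
    by (cases "v = apex \<sigma>"; cases "v \<in> \<sigma>") (simp_all, (intro continuous_intros e continuous_on_product_coordinates)+)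
  then have "continuous_on UNIV (\<lambda>x. push x v)" for v
    unfolding push_def by (intro continuous_intros continuous_on_product_coordinates)
  then show ?thesis
    by (rule continuous_on_coordinatewise_then_product)
qed

theorem realization_homotopy_equivalent_core:
  "geometric_realization K homotopy_equivalent_space geometric_realization core"
proof -
  let ?X = "realization_points K" and ?Y = "realization_points core"
  have sub: "?Y \<subseteq> ?X"
    by (auto simp: realization_points_def core_def)
  have r: "continuous_on ?X push" "push \<in> ?X \<rightarrow> ?Y"
    using continuous_on_push push_in_core by (auto intro: continuous_on_subset simp: Pi_iff)
  \<comment> \<open>The homotopy runs from \<open>push\<close> at \<open>t = 0\<close> to the
    identity at \<open>t = 1\<close>.\<close>
  have h: "continuous_on ({0..1} \<times> ?X) (\<lambda>(t, x) v. (1 - t) * push x v + t * x v)"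
  proof -
    have "continuous_on ({0..1} \<times> ?X) (\<lambda>z. push (snd z) v)" for v
      by (rule continuous_on_product_then_coordinatewise, rule continuous_on_compose2[OF continuous_on_push])
         (auto intro: continuous_intros)
    moreover have "continuous_on ({0..1} \<times> ?X) (\<lambda>z. snd z v)" for v
      by (rule continuous_on_product_then_coordinatewise) (auto intro: continuous_intros)
    ultimately show ?thesis
      unfolding case_prod_unfold
      by (intro continuous_on_coordinatewise_then_product continuous_intros)
  qed
  have "homotopic_with (\<lambda>_. True) (top_of_set ?X) (top_of_set ?X) (id \<circ> push) id"
    unfolding homotopic_with_def
  proof (intro exI conjI)
    show "continuous_map (prod_topology (top_of_set {0..1}) (top_of_set ?X)) (top_of_set ?X)
        (\<lambda>(t, x) v. (1 - t) * push x v + t * x v)"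
    proof -
      have "(\<lambda>v. (1 - t) * push x v + t * x v) \<in> ?X" if "x \<in> ?X" "0 \<le> t" "t \<le> 1" for t x
        using push_in_core[OF that(1)] that segment_in_realization sub by blast
      with h show ?thesis
        by (auto simp: continuous_map_subtopology_eu)
    qed
  qed auto
  moreover have "retraction_maps (top_of_set ?X) (top_of_set ?Y) push id"
    using r sub push_eq_self by (auto simp: retraction_maps_def continuous_map_subtopology_eu)
  ultimately show ?thesis
    unfolding geometric_realization_eq by (rule deformation_retraction_imp_homotopy_equivalent_space)
qed

end

section \<open>Finite simplicial complexes as CW-complexes\<close>

lemma continuous_on_Max_image:
  fixes f :: "'i \<Rightarrow> 'a::topological_space \<Rightarrow> real"
  assumes "finite A" "A \<noteq> {}" "\<And>a. a \<in> A \<Longrightarrow> continuous_on S (f a)"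
  shows "continuous_on S (\<lambda>x. Max ((\<lambda>a. f a x) ` A))"
  using assms
proof (induction rule: finite_ne_induct)
  case (insert a A)
  then show ?case
    by (auto intro!: continuous_on_max)
qed auto

section \<open>The Euclidean ball\<close>

definition disc_points :: "nat \<Rightarrow> (nat \<Rightarrow> real) set" where
  "disc_points k = {u. (\<forall>i\<ge>k. u i = 0) \<and> (\<Sum>i<k. u i ^ 2) \<le> 1}"

lemma disc_eq: "disc k = top_of_set (disc_points k)"
  by (simp add: disc_def disc_points_def Euclidean_space_def euclidean_product_topology
      subtopology_subtopology Int_def)

text \<open>The points are functions on all of \<open>nat\<close>, so compactness comes from
  Tychonoff: the ball is closed in the cube \<open>?B\<close>.\<close>

lemma compact_disc_points: "compact (disc_points k)"
proof -
  let ?B = "PiE UNIV (\<lambda>i::nat. {-1..1::real})"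
  have "compactin (powertop_real UNIV) ?B"
    by (subst compactin_PiE) auto
  then have "compact ?B"
    by (simp add: euclidean_product_topology)
  moreover have "closed (disc_points k)"
    unfolding disc_points_def
    by (intro closed_Collect_conj closed_Collect_all closed_Collect_imp closed_Collect_eq closed_Collect_le
        continuous_intros continuous_on_product_coordinates) auto
  moreover have "disc_points k \<subseteq> ?B"
  proof
    fix u assume u: "u \<in> disc_points k"
    have "\<bar>u i\<bar> \<le> 1" for i
    proof (cases "i < k")
      case True
      then have "u i ^ 2 \<le> (\<Sum>i<k. u i ^ 2)"
        by (intro member_le_sum) auto
      also have "\<dots> \<le> 1"
        using u by (simp add: disc_points_def)
      finally show ?thesis
        by (simp add: abs_square_le_1)
    qed (use u in \<open>auto simp: disc_points_def\<close>)
    then show "u \<in> ?B"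
      by (auto simp: abs_le_iff minus_le_iff)
  qed
  ultimately show ?thesis
    by (metis compact_Int_closed inf.absorb_iff2)
qed

text \<open>The barycentric coordinates of a \<open>k\<close>-simplex, minus those of the barycentre, are parametrized by
  \<open>zero_sum k\<close>; in these coordinates the simplex is the unit ball of \<open>simplex_gauge k\<close>. Rescaling rays
  turns the Euclidean ball into it; at \<open>u = 0\<close> the quotient in \<open>radial\<close> is \<open>0 / 0 = 0\<close>.\<close>

definition zero_sum :: "nat \<Rightarrow> (nat \<Rightarrow> real) \<Rightarrow> nat \<Rightarrow> real" where
  "zero_sum k u i = (if i < k then u i else - (\<Sum>j<k. u j))"

definition simplex_gauge :: "nat \<Rightarrow> (nat \<Rightarrow> real) \<Rightarrow> real" where
  "simplex_gauge k u = Max ((\<lambda>i. - (real k + 1) * zero_sum k u i) ` {..k})"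

definition radius :: "nat \<Rightarrow> (nat \<Rightarrow> real) \<Rightarrow> real" where
  "radius k u = sqrt (\<Sum>i<k. u i ^ 2)"

definition radial :: "nat \<Rightarrow> (nat \<Rightarrow> real) \<Rightarrow> nat \<Rightarrow> real" where
  "radial k u i = 1 / (real k + 1) + radius k u / simplex_gauge k u * zero_sum k u i"

section \<open>The radial map from the ball to the simplex\<close>

lemma sum_zero_sum: "(\<Sum>i\<le>k. zero_sum k u i) = 0"
  by (simp add: zero_sum_def flip: lessThan_Suc_atMost)

lemma zero_sum_0: "zero_sum k (\<lambda>_. 0) i = 0"
  by (simp add: zero_sum_def)

lemma zero_sum_scale: "zero_sum k (\<lambda>i. t * u i) i = t * zero_sum k u i"
  by (simp add: zero_sum_def sum_distrib_left)

lemma simplex_gauge_le_iff: "simplex_gauge k u \<le> r \<longleftrightarrow> (\<forall>i\<le>k. - (real k + 1) * zero_sum k u i \<le> r)"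
  unfolding simplex_gauge_def by (subst Max_le_iff) auto

lemma simplex_gauge_less_iff: "simplex_gauge k u < r \<longleftrightarrow> (\<forall>i\<le>k. - (real k + 1) * zero_sum k u i < r)"
  unfolding simplex_gauge_def by (subst Max_less_iff) auto

lemma simplex_gauge_scale:
  assumes "0 \<le> t" shows "simplex_gauge k (\<lambda>i. t * u i) = t * simplex_gauge k u"
proof -
  have "t * simplex_gauge k u = Max ((*) t ` (\<lambda>i. - (real k + 1) * zero_sum k u i) ` {..k})"
    unfolding simplex_gauge_def
    by (rule mono_Max_commute) (use assms in \<open>auto intro: monoI mult_left_mono\<close>)
  then show ?thesis
    unfolding simplex_gauge_def zero_sum_scale image_image by (simp add: mult.left_commute)
qed

lemma radius_scale: "0 \<le> t \<Longrightarrow> radius k (\<lambda>i. t * u i) = t * radius k u"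
  by (simp add: radius_def power_mult_distrib real_sqrt_mult flip: sum_distrib_left)

lemma radius_nonneg: "0 \<le> radius k u"
  by (simp add: radius_def sum_nonneg)

lemma radius_eq_0_iff:
  assumes "\<forall>i\<ge>k. u i = 0"
  shows "radius k u = 0 \<longleftrightarrow> u = (\<lambda>_. 0)"
proof
  assume "radius k u = 0"
  then have "u i = 0" if "i < k" for i
    using that by (simp add: radius_def sum_nonneg_eq_0_iff)
  with assms show "u = (\<lambda>_. 0)"
    by (metis not_less ext)
qed (simp add: radius_def)

text \<open>The gauge bounds all coordinates from below. As they sum to zero, each is minus the sum
  of the other \<open>k\<close>, which bounds it from above as well.\<close>

lemma zero_sum_bound: "\<bar>zero_sum k u i\<bar> \<le> simplex_gauge k u" if "i \<le> k"
proof -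
  have g: "- zero_sum k u j \<le> simplex_gauge k u / (real k + 1)" if "j \<le> k" for j
    using simplex_gauge_le_iff[of k u "simplex_gauge k u"] that by (simp add: field_simps)
  have "(\<Sum>j\<le>k. - zero_sum k u j) \<le> (\<Sum>j\<le>k. simplex_gauge k u / (real k + 1))"
    using g by (intro sum_mono) auto
  then have pos: "0 \<le> simplex_gauge k u"
    by (simp add: sum_negf sum_zero_sum zero_le_divide_iff zero_le_mult_iff)
  have "zero_sum k u i = (\<Sum>j\<in>{..k} - {i}. - zero_sum k u j)"
    using sum_zero_sum[of k u] that by (simp add: sum_negf sum.remove[of "{..k}" i])
  also have "\<dots> \<le> (\<Sum>j\<in>{..k} - {i}. simplex_gauge k u / (real k + 1))"
    using g by (intro sum_mono) auto
  also have "\<dots> \<le> simplex_gauge k u"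
    using that pos by (simp add: field_simps)
  finally have "zero_sum k u i \<le> simplex_gauge k u" .
  moreover have "simplex_gauge k u / (real k + 1) \<le> simplex_gauge k u"
    using pos by (simp add: field_simps)
  ultimately show ?thesis
    using g[OF that] by linarith
qed

lemma simplex_gauge_nonneg: "0 \<le> simplex_gauge k u"
  using zero_sum_bound[of 0 k u] by linarith

lemma simplex_gauge_eq_0_iff:
  assumes "\<forall>i\<ge>k. u i = 0"
  shows "simplex_gauge k u = 0 \<longleftrightarrow> u = (\<lambda>_. 0)"
proof
  assume 0: "simplex_gauge k u = 0"
  show "u = (\<lambda>_. 0)"
  proof
    fix i show "u i = 0"
      using assms zero_sum_bound[of i k u] 0 by (cases "i < k") (auto simp: zero_sum_def)
  qed
qed (auto simp: simplex_gauge_def zero_sum_0 image_constant_conv)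

lemma radial_scaled:
  "radial k u i = 1 / (real k + 1) + zero_sum k (\<lambda>i. radius k u / simplex_gauge k u * u i) i"
  by (simp only: radial_def zero_sum_scale)

text \<open>By homogeneity the gauge cancels, and at the origin both sides are 0. Rescaling thus
  carries each Euclidean sphere to the gauge sphere of the same radius.\<close>

lemma simplex_gauge_radial:
  assumes "\<forall>i\<ge>k. u i = 0"
  shows "simplex_gauge k (\<lambda>i. radius k u / simplex_gauge k u * u i) = radius k u"
  using simplex_gauge_eq_0_iff[OF assms] radius_eq_0_iff[OF assms]
  by (subst simplex_gauge_scale) (auto simp: simplex_gauge_nonneg radius_nonneg)

lemma sum_radial: "(\<Sum>i\<le>k. radial k u i) = 1"
  by (simp add: radial_scaled sum.distrib sum_zero_sum)

text \<open>This explains the factor \<open>real k + 1\<close> in \<open>simplex_gauge\<close>: the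
  unit ball of the gauge is where all barycentric coordinates are nonnegative.\<close>

lemma barycentric_le_iff: "0 \<le> 1 / (real k + 1) + z \<longleftrightarrow> - (real k + 1) * z \<le> 1"
  and barycentric_less_iff: "0 < 1 / (real k + 1) + z \<longleftrightarrow> - (real k + 1) * z < 1"
  by (auto simp: field_simps)

lemma radial_nonneg_iff:
  assumes "\<forall>i\<ge>k. u i = 0"
  shows "(\<forall>i\<le>k. 0 \<le> radial k u i) \<longleftrightarrow> (\<Sum>i<k. u i ^ 2) \<le> 1"
proof -
  have "(\<Sum>i<k. u i ^ 2) \<le> 1 \<longleftrightarrow> radius k u \<le> 1"
    by (simp add: radius_def)
  also have "\<dots> \<longleftrightarrow> (\<forall>i\<le>k. 0 \<le> radial k u i)"
    using simplex_gauge_le_iff[of k "\<lambda>i. radius k u / simplex_gauge k u * u i" 1]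
    by (simp only: simplex_gauge_radial[OF assms] radial_scaled barycentric_le_iff)
  finally show ?thesis by simp
qed

lemma radial_pos_iff:
  assumes "\<forall>i\<ge>k. u i = 0"
  shows "(\<forall>i\<le>k. 0 < radial k u i) \<longleftrightarrow> (\<Sum>i<k. u i ^ 2) < 1"
proof -
  have "(\<Sum>i<k. u i ^ 2) < 1 \<longleftrightarrow> radius k u < 1"
    by (simp add: radius_def)
  also have "\<dots> \<longleftrightarrow> (\<forall>i\<le>k. 0 < radial k u i)"
    using simplex_gauge_less_iff[of k "\<lambda>i. radius k u / simplex_gauge k u * u i" 1]
    by (simp only: simplex_gauge_radial[OF assms] radial_scaled barycentric_less_iff)
  finally show ?thesis by simp
qed

text \<open>Equal images give equal rescaled vectors \<open>p * u\<close> and \<open>q * v\<close>.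
  Their gauges show that the radii agree, and their radii then show \<open>p = q\<close> away from
  the origin.\<close>

lemma radial_inject:
  assumes u: "\<forall>i\<ge>k. u i = 0" and v: "\<forall>i\<ge>k. v i = 0"
    and eq: "\<forall>i\<le>k. radial k u i = radial k v i"
  shows "u = v"
proof -
  define p q where "p = radius k u / simplex_gauge k u" and "q = radius k v / simplex_gauge k v"
  have nonneg: "0 \<le> p" "0 \<le> q"
    by (auto simp: p_def q_def radius_nonneg simplex_gauge_nonneg)
  have pq: "(\<lambda>i. p * u i) = (\<lambda>i. q * v i)"
  proof
    fix i show "p * u i = q * v i"
    proof (cases "i < k")
      case True
      with eq have "radial k u i = radial k v i" by simp
      with True show ?thesis
        by (simp add: radial_def p_def q_def zero_sum_def)
    qed (use u v in auto)
  qed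
  then have r: "radius k u = radius k v"
    using simplex_gauge_radial[OF u] simplex_gauge_radial[OF v] by (simp add: p_def q_def)
  have "p * radius k u = q * radius k v"
    using radius_scale[OF nonneg(1), of k u] radius_scale[OF nonneg(2), of k v] pq by simp
  show ?thesis
  proof (cases "radius k u = 0")
    case True
    then show ?thesis
      using radius_eq_0_iff[OF u] radius_eq_0_iff[OF v] r by simp
  next
    case False
    with r \<open>p * radius k u = q * radius k v\<close> have "p = q" by simp
    moreover have "simplex_gauge k u \<noteq> 0"
      using False simplex_gauge_eq_0_iff[OF u] radius_eq_0_iff[OF u] by simp
    then have "p \<noteq> 0"
      using False by (simp add: p_def)
    ultimately show ?thesis
      using pq by (simp add: fun_eq_iff)
  qed
qed

text \<open>Here \<open>w\<close> is the displacement of \<open>y\<close> from the barycentre, its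
  last coordinate being forced by the sum, and \<open>u\<close> undoes the rescaling with the
  inverse factor.\<close>

lemma radial_surj:
  assumes y: "\<forall>i\<le>k. 0 \<le> y i" "(\<Sum>i\<le>k. y i) = 1"
  obtains u where "u \<in> disc_points k" "\<forall>i\<le>k. radial k u i = y i"
proof -
  define w where "w i = (if i < k then y i - 1 / (real k + 1) else 0)" for i
  define u where "u i = simplex_gauge k w / radius k w * w i" for i
  have w0: "\<forall>i\<ge>k. w i = 0" and u0: "\<forall>i\<ge>k. u i = 0"
    by (simp_all add: w_def u_def)
  have "(\<Sum>i<k. y i) + y k = 1"
    using y(2) by (simp flip: lessThan_Suc_atMost)
  moreover have "1 - real k / (1 + real k) = 1 / (1 + real k)"
    by (simp add: field_simps)
  ultimately have zw: "zero_sum k w i = y i - 1 / (real k + 1)" if "i \<le> k" for i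
    using that by (cases "i = k") (auto simp: zero_sum_def w_def sum_subtractf add.commute algebra_simps)
  have u_alt: "u = (\<lambda>i. simplex_gauge k w / radius k w * w i)"
    by (simp add: u_def fun_eq_iff)
  have "radial k u i = y i" if "i \<le> k" for i
  proof (cases "w = (\<lambda>_. 0)")
    case True
    then have "u = (\<lambda>_. 0)" by (simp add: u_def fun_eq_iff)
    then show ?thesis
      using zw[OF that] True by (simp add: radial_def zero_sum_0)
  next
    case False
    then have nz: "simplex_gauge k w \<noteq> 0" "radius k w \<noteq> 0"
      using simplex_gauge_eq_0_iff[OF w0] radius_eq_0_iff[OF w0] by auto
    have t: "0 \<le> simplex_gauge k w / radius k w"
      by (simp add: simplex_gauge_nonneg radius_nonneg)
    have "radius k u = simplex_gauge k w"
      using nz unfolding u_alt radius_scale[OF t] by simp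
    moreover have "simplex_gauge k u = simplex_gauge k w / radius k w * simplex_gauge k w"
      unfolding u_alt by (rule simplex_gauge_scale[OF t])
    moreover have "zero_sum k u i = simplex_gauge k w / radius k w * zero_sum k w i"
      unfolding u_alt by (rule zero_sum_scale)
    ultimately show ?thesis
      using nz zw[OF that] by (simp add: radial_def)
  qed
  moreover from this have "u \<in> disc_points k"
    using radial_nonneg_iff[OF u0] y u0 by (simp add: disc_points_def)
  ultimately show ?thesis
    using that by blast
qed

lemma continuous_on_radial:
  assumes "i \<le> k"
  shows "continuous_on (disc_points k) (\<lambda>u. radial k u i)"
proof -
  have c: "continuous_on UNIV (\<lambda>u. zero_sum k u j)" for j
    unfolding zero_sum_def by (cases "j < k") (auto intro!: continuous_intros)
  have g: "continuous_on UNIV (simplex_gauge k)"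
    unfolding simplex_gauge_def by (rule continuous_on_Max_image) (auto intro!: continuous_intros c)
  have r: "continuous_on UNIV (radius k)"
    unfolding radius_def by (intro continuous_intros continuous_on_product_coordinates)
  note lims = c[of i] g r
  have "((\<lambda>u. radius k u / simplex_gauge k u * zero_sum k u i)
      \<longlongrightarrow> radius k x / simplex_gauge k x * zero_sum k x i) (at x within disc_points k)"
    if x: "x \<in> disc_points k" for x
  proof (cases "x = (\<lambda>_. 0)")
    case False
    then have "simplex_gauge k x \<noteq> 0"
      using simplex_gauge_eq_0_iff[of k x] x by (simp add: disc_points_def)
    moreover have "(f \<longlongrightarrow> f x) (at x within disc_points k)" if "continuous_on UNIV f" for f :: "_ \<Rightarrow> real"
      using continuous_on_subset[OF that subset_UNIV, of "disc_points k"] x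
      by (simp add: continuous_on_def)
    ultimately show ?thesis
      using lims by (intro tendsto_intros)
  next
    case True
    have "(radius k \<longlongrightarrow> radius k x) (at x within disc_points k)"
      using continuous_on_subset[OF r subset_UNIV, of "disc_points k"] x
      by (simp add: continuous_on_def)
    moreover have rx: "radius k x = 0"
      using True by (simp add: radius_def)
    ultimately have r0: "(radius k \<longlongrightarrow> 0) (at x within disc_points k)"
      by simp
    \<comment> \<open>At the centre the quotient alone need not converge, but
      \<open>zero_sum_bound\<close> squeezes the whole product by the radius, which tends to
      0.\<close>
    have bound: "\<bar>radius k u / simplex_gauge k u * zero_sum k u i\<bar> \<le> radius k u" for u
    proof -
      have "\<bar>radius k u / simplex_gauge k u * zero_sum k u i\<bar> = radius k u * (\<bar>zero_sum k u i\<bar> / simplex_gauge k u)"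
        by (simp add: abs_mult radius_nonneg simplex_gauge_nonneg)
      also have "\<dots> \<le> radius k u * 1"
        using zero_sum_bound[OF assms, of u]
        by (intro mult_left_mono radius_nonneg) (auto simp: divide_le_eq_1 simplex_gauge_nonneg le_less)
      finally show ?thesis by simp
    qed
    have "((\<lambda>u. radius k u / simplex_gauge k u * zero_sum k u i) \<longlongrightarrow> 0) (at x within disc_points k)"
      by (rule Lim_null_comparison[OF _ r0]) (intro always_eventually allI, simp only: real_norm_def bound)
    then show ?thesis
      using rx by simp
  qed
  then have "continuous_on (disc_points k) (\<lambda>u. radius k u / simplex_gauge k u * zero_sum k u i)"
    by (simp add: continuous_on_def)
  then show ?thesis
    unfolding radial_def by (intro continuous_on_add continuous_on_const)
qed

section \<open>Characteristic maps of simplices\<close>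

definition closed_simplex :: "'v set \<Rightarrow> ('v \<Rightarrow> real) set" where
  "closed_simplex \<sigma> = {x. (\<forall>v. 0 \<le> x v) \<and> supp x \<subseteq> \<sigma> \<and> sum x \<sigma> = 1}"

text \<open>For a simplex the map is injective even on the closed disc, so compactness makes it a
  homeomorphism onto the closed simplex; the last conjunct singles out the open cell.\<close>

definition characteristic_map :: "'v set \<Rightarrow> ((nat \<Rightarrow> real) \<Rightarrow> 'v \<Rightarrow> real) \<Rightarrow> bool" where
  "characteristic_map \<sigma> \<phi> \<longleftrightarrow>
     continuous_on (disc_points (card \<sigma> - 1)) \<phi> \<and> inj_on \<phi> (disc_points (card \<sigma> - 1)) \<and>
     \<phi> ` disc_points (card \<sigma> - 1) = closed_simplex \<sigma> \<and>
     (\<forall>u\<in>disc_points (card \<sigma> - 1). supp (\<phi> u) = \<sigma> \<longleftrightarrow> (\<Sum>i<card \<sigma> - 1. u i ^ 2) < 1)"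

lemma ex_characteristic_map:
  fixes \<sigma> :: "'v set"
  assumes "finite \<sigma>" "\<sigma> \<noteq> {}"
  shows "\<exists>\<phi>. characteristic_map \<sigma> \<phi>"
proof -
  define k where "k = card \<sigma> - 1"
  \<comment> \<open>Nonemptiness makes the truncated subtraction in \<open>k\<close> exact, so
    \<open>{..k}\<close> can number the vertices.\<close>
  have "0 < card \<sigma>" using assms by (simp add: card_gt_0_iff)
  then have "card {..k} = card \<sigma>" by (simp add: k_def)
  then obtain h where h: "bij_betw h \<sigma> {..k}"
    using assms by (metis finite_atMost finite_same_card_bij)
  define g where "g = inv_into \<sigma> h"
  have g: "bij_betw g {..k} \<sigma>" and hg: "\<And>i. i \<le> k \<Longrightarrow> h (g i) = i" and gh: "\<And>v. v \<in> \<sigma> \<Longrightarrow> g (h v) = v"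
    using bij_betw_inv_into[OF h] bij_betw_inv_into_right[OF h] bij_betw_inv_into_left[OF h] by (auto simp: g_def)
  have hk: "h v \<le> k" if "v \<in> \<sigma>" for v
    using bij_betwE[OF h] that by auto
  have g\<sigma>: "g i \<in> \<sigma>" if "i \<le> k" for i
    using bij_betwE[OF g] that by auto
  define \<phi> where "\<phi> u v = (if v \<in> \<sigma> then radial k u (h v) else 0)" for u v
  have \<phi>g: "\<phi> u (g i) = radial k u i" if "i \<le> k" for u i
    using that by (simp add: \<phi>_def hg g\<sigma>)
  have ball: "(\<forall>v\<in>\<sigma>. P (\<phi> u v)) \<longleftrightarrow> (\<forall>i\<le>k. P (radial k u i))" for P u
    using \<phi>g g\<sigma> hk gh by (metis)
  have "continuous_on (disc_points k) \<phi>"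
  proof (rule continuous_on_coordinatewise_then_product)
    fix v show "continuous_on (disc_points k) (\<lambda>u. \<phi> u v)"
      by (cases "v \<in> \<sigma>") (simp_all add: \<phi>_def continuous_on_radial hk)
  qed
  moreover have "inj_on \<phi> (disc_points k)"
  proof (rule inj_onI)
    fix u u' assume "u \<in> disc_points k" "u' \<in> disc_points k" "\<phi> u = \<phi> u'"
    then show "u = u'"
      using \<phi>g by (intro radial_inject[of k]) (auto simp: disc_points_def, metis)
  qed
  moreover have "\<phi> ` disc_points k = closed_simplex \<sigma>"
  proof (intro equalityI subsetI)
    fix x assume "x \<in> \<phi> ` disc_points k"
    then obtain u where u: "u \<in> disc_points k" "x = \<phi> u" by auto
    have "\<forall>v\<in>\<sigma>. 0 \<le> x v"
      using u radial_nonneg_iff[of k u] ball[of "\<lambda>r. 0 \<le> r" u] by (auto simp: disc_points_def)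
    then have "\<forall>v. 0 \<le> x v"
      using u by (auto simp: \<phi>_def)
    moreover have "sum x \<sigma> = (\<Sum>i\<le>k. radial k u i)"
      using sum.reindex_bij_betw[OF g, of x] \<phi>g u by simp
    ultimately show "x \<in> closed_simplex \<sigma>"
      using u by (auto simp: closed_simplex_def sum_radial supp_def \<phi>_def)
  next
    fix x assume x: "x \<in> closed_simplex \<sigma>"
    have "(\<Sum>i\<le>k. x (g i)) = 1"
      using sum.reindex_bij_betw[OF g, of x] x by (simp add: closed_simplex_def)
    moreover have "\<forall>i\<le>k. 0 \<le> x (g i)"
      using x by (simp add: closed_simplex_def)
    ultimately obtain u where u: "u \<in> disc_points k" "\<forall>i\<le>k. radial k u i = x (g i)"
      using radial_surj[of k "\<lambda>i. x (g i)"] by metis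
    have "\<phi> u = x"
    proof
      fix v show "\<phi> u v = x v"
        using u hk gh x by (auto simp: \<phi>_def closed_simplex_def supp_def)
    qed
    with u show "x \<in> \<phi> ` disc_points k" by auto
  qed
  moreover have "supp (\<phi> u) = \<sigma> \<longleftrightarrow> (\<Sum>i<k. u i ^ 2) < 1" if u: "u \<in> disc_points k" for u
  proof -
    have "\<forall>i\<le>k. 0 \<le> radial k u i"
      using u radial_nonneg_iff[of k u] by (auto simp: disc_points_def)
    then have nn: "\<forall>v\<in>\<sigma>. 0 \<le> \<phi> u v"
      using ball[of "\<lambda>r. 0 \<le> r" u] by simp
    have "supp (\<phi> u) = \<sigma> \<longleftrightarrow> (\<forall>v\<in>\<sigma>. \<phi> u v \<noteq> 0)"
      by (auto simp: supp_def \<phi>_def)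
    also have "\<dots> \<longleftrightarrow> (\<forall>v\<in>\<sigma>. 0 < \<phi> u v)"
      using nn by (auto simp: less_le)
    also have "\<dots> \<longleftrightarrow> (\<Sum>i<k. u i ^ 2) < 1"
      using ball[of "\<lambda>r. 0 < r" u] radial_pos_iff[of k u] u by (simp add: disc_points_def)
    finally show ?thesis .
  qed
  ultimately show ?thesis
    unfolding characteristic_map_def k_def[symmetric] by blast
qed

text \<open>With finitely many cells the weak topology is automatic: \<open>A\<close> is a finite
  union of closed pieces.\<close>

lemma closedin_iff_closure_pieces:
  assumes "finite E" "\<Union>E = topspace X" "A \<subseteq> topspace X"
  shows "closedin X A \<longleftrightarrow> (\<forall>e\<in>E. closedin (subtopology X (X closure_of e)) (A \<inter> X closure_of e))"
proof
  assume "closedin X A"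
  then show "\<forall>e\<in>E. closedin (subtopology X (X closure_of e)) (A \<inter> X closure_of e)"
    by (auto simp: closedin_subtopology)
next
  assume *: "\<forall>e\<in>E. closedin (subtopology X (X closure_of e)) (A \<inter> X closure_of e)"
  have sub: "e \<subseteq> X closure_of e" if "e \<in> E" for e
    using assms(2) that by (intro closure_of_subset) auto
  have "A = (\<Union>e\<in>E. A \<inter> X closure_of e)"
  proof (intro equalityI subsetI)
    fix x assume "x \<in> A"
    moreover from this obtain e where "e \<in> E" "x \<in> e"
      using assms(2,3) by auto
    ultimately show "x \<in> (\<Union>e\<in>E. A \<inter> X closure_of e)"
      using sub by auto
  qed auto
  moreover have "closedin X (A \<inter> X closure_of e)" if "e \<in> E" for e
    using closedin_trans_full[OF _ closedin_closure_of] * that by blast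
  then have "closedin X (\<Union>e\<in>E. A \<inter> X closure_of e)"
    using assms(1) by (intro closedin_Union) auto
  ultimately show "closedin X A" by simp
qed

lemma Hausdorff_top_of_set_fun: "Hausdorff_space (top_of_set (S :: ('v \<Rightarrow> real) set))"
proof -
  have "Hausdorff_space (powertop_real (UNIV :: 'v set))"
    by (subst Hausdorff_space_product_topology) auto
  then show ?thesis
    by (metis Hausdorff_space_subtopology euclidean_product_topology)
qed

section \<open>The cell structure given by the open simplices\<close>

context finite_complex
begin

definition open_simplex :: "'v set \<Rightarrow> ('v \<Rightarrow> real) set" where
  "open_simplex \<sigma> = {x \<in> realization_points K. supp x = \<sigma>}"

lemma closed_simplex_subset:
  assumes "\<sigma> \<in> K" shows "closed_simplex \<sigma> \<subseteq> realization_points K"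
  using realization_pointsI[OF assms] by (auto simp: closed_simplex_def)

lemma open_simplex_eq:
  assumes "\<sigma> \<in> K" shows "open_simplex \<sigma> = {x \<in> closed_simplex \<sigma>. supp x = \<sigma>}"
  using closed_simplex_subset[OF assms] by (auto simp: open_simplex_def closed_simplex_def realization_points_def)

text \<open>The barycentre is a witness. A point is needed for a cell to determine its
  simplex.\<close>

lemma open_simplex_nonempty:
  assumes "\<sigma> \<in> K" shows "open_simplex \<sigma> \<noteq> {}"
proof -
  define x where "x v = (if v \<in> \<sigma> then 1 / real (card \<sigma>) else 0)" for v
  have "0 < card \<sigma>"
    using assms finite_simplex simplex_nonempty by (simp add: card_gt_0_iff)
  then have "x \<in> closed_simplex \<sigma>" "supp x = \<sigma>"
    by (auto simp: x_def closed_simplex_def supp_def)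
  then show ?thesis
    using open_simplex_eq[OF assms] by auto
qed

theorem CW_complex_realization:
  assumes dim: "\<And>\<sigma>. \<sigma> \<in> K \<Longrightarrow> card \<sigma> \<le> Suc d"
  shows "CW_complex_dim_le d (geometric_realization K)"
proof -
  let ?X = "geometric_realization K"
  have X: "?X = top_of_set (realization_points K)"
    by (rule geometric_realization_eq)
  define \<phi> where "\<phi> \<sigma> = (SOME f. characteristic_map \<sigma> f)" for \<sigma> :: "'v set"
  have \<phi>: "characteristic_map \<sigma> (\<phi> \<sigma>)" if "\<sigma> \<in> K" for \<sigma>
    unfolding \<phi>_def
    by (rule someI_ex[OF ex_characteristic_map[OF finite_simplex[OF that] simplex_nonempty[OF that]]])
  note \<phi> = \<phi>[unfolded characteristic_map_def, THEN conjunct1]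
    \<phi>[unfolded characteristic_map_def, THEN conjunct2, THEN conjunct1]
    \<phi>[unfolded characteristic_map_def, THEN conjunct2, THEN conjunct2, THEN conjunct1]
    \<phi>[unfolded characteristic_map_def, THEN conjunct2, THEN conjunct2, THEN conjunct2, THEN bspec]
  define E where "E = open_simplex ` K"
  \<comment> \<open>The simplex can be read off an open cell as the common support of its points.\<close>
  define carrier where "carrier e = supp (SOME x. x \<in> e)" for e :: "('v \<Rightarrow> real) set"
  define dm where "dm e = card (carrier e) - 1" for e
  have carrier: "carrier (open_simplex \<sigma>) = \<sigma>" if "\<sigma> \<in> K" for \<sigma>
    using someI_ex[of "\<lambda>x. x \<in> open_simplex \<sigma>"] open_simplex_nonempty[OF that]
    by (auto simp: carrier_def open_simplex_def)
  have E_cases: "\<exists>\<sigma>\<in>K. e = open_simplex \<sigma> \<and> carrier e = \<sigma>" if "e \<in> E" for e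
    using that carrier by (auto simp: E_def)
  have cover: "\<Union>E = topspace ?X"
    by (auto simp: E_def X open_simplex_def realization_points_def)
  have finE: "finite E"
    by (simp add: E_def finite_complex)
  have haus: "Hausdorff_space ?X"
    unfolding X by (rule Hausdorff_top_of_set_fun)
  have "disjoint E"
    by (auto simp: disjoint_def E_def open_simplex_def)
  have maps: "continuous_map (disc (dm e)) ?X (\<phi> (carrier e)) \<and>
      homeomorphic_map (subtopology (disc (dm e)) (open_disc (dm e))) (subtopology ?X e) (\<phi> (carrier e))"
    if e: "e \<in> E" for e
  proof -
    obtain \<sigma> where \<sigma>: "\<sigma> \<in> K" "e = open_simplex \<sigma>" "carrier e = \<sigma>"
      using E_cases[OF e] by auto
    let ?k = "card \<sigma> - 1"
    have c: "continuous_map (disc ?k) (top_of_set (closed_simplex \<sigma>)) (\<phi> \<sigma>)"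
      using \<phi>[OF \<sigma>(1)] by (auto simp: disc_eq)
    then have "continuous_map (disc ?k) ?X (\<phi> \<sigma>)"
      using closed_simplex_subset[OF \<sigma>(1)] \<phi>(1,3)[OF \<sigma>(1)] by (auto simp: X disc_eq)
    \<comment> \<open>A continuous bijection from a compact space to a Hausdorff space is a
      homeomorphism.\<close>
    have "homeomorphic_map (disc ?k) (top_of_set (closed_simplex \<sigma>)) (\<phi> \<sigma>)"
      by (rule continuous_imp_homeomorphic_map[OF c])
        (use \<phi>[OF \<sigma>(1)] compact_disc_points in \<open>auto simp: disc_eq compact_space_subtopology Hausdorff_top_of_set_fun\<close>)
    then have "homeomorphic_map (subtopology (disc ?k) (open_disc ?k))
        (subtopology (top_of_set (closed_simplex \<sigma>)) (open_simplex \<sigma>)) (\<phi> \<sigma>)"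
    proof (rule homeomorphic_map_subtopologies_alt)
      fix u assume u: "u \<in> topspace (disc ?k)" "\<phi> \<sigma> u \<in> topspace (top_of_set (closed_simplex \<sigma>))"
      then show "\<phi> \<sigma> u \<in> open_simplex \<sigma> \<longleftrightarrow> u \<in> open_disc ?k"
        using \<phi>(4)[OF \<sigma>(1), of u] by (simp add: open_simplex_eq[OF \<sigma>(1)] open_disc_def disc_eq)
    qed
    moreover have "subtopology (top_of_set (closed_simplex \<sigma>)) (open_simplex \<sigma>) = subtopology ?X (open_simplex \<sigma>)"
      using closed_simplex_subset[OF \<sigma>(1)] open_simplex_eq[OF \<sigma>(1)]
      by (simp add: X subtopology_subtopology) (metis (no_types, lifting) Int_absorb1 mem_Collect_eq subset_iff)
    ultimately show ?thesis
      using \<open>continuous_map (disc ?k) ?X (\<phi> \<sigma>)\<close> \<sigma> by (simp add: dm_def)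
  qed
  have boundary: "\<exists>F. finite F \<and> F \<subseteq> E \<and> (\<forall>f\<in>F. dm f < dm e) \<and> \<phi> (carrier e) ` disc_boundary (dm e) \<subseteq> \<Union>F"
    if e: "e \<in> E" for e
  proof -
    obtain \<sigma> where \<sigma>: "\<sigma> \<in> K" "e = open_simplex \<sigma>" "carrier e = \<sigma>"
      using E_cases[OF e] by auto
    \<comment> \<open>A boundary point loses a vertex from its support, hence lies in the open
      simplex of a proper face.\<close>
    let ?F = "open_simplex ` {\<tau> \<in> K. \<tau> \<subset> \<sigma>}"
    have "dm (open_simplex \<tau>) < dm e" if "\<tau> \<in> K" "\<tau> \<subset> \<sigma>" for \<tau>
    proof -
      have "card \<tau> < card \<sigma>" "0 < card \<tau>"
        using that \<sigma> finite_simplex simplex_nonempty by (auto intro: psubset_card_mono simp: card_gt_0_iff)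
      then show ?thesis
        using carrier that \<sigma> by (simp add: dm_def)
    qed
    moreover have "\<phi> \<sigma> u \<in> \<Union>?F" if "u \<in> disc_boundary (card \<sigma> - 1)" for u
    proof -
      have u: "u \<in> disc_points (card \<sigma> - 1)" "\<not> (\<Sum>i<card \<sigma> - 1. u i ^ 2) < 1"
        using that by (auto simp: disc_boundary_def disc_eq)
      then have "\<phi> \<sigma> u \<in> closed_simplex \<sigma>" "supp (\<phi> \<sigma> u) \<noteq> \<sigma>"
        using \<phi>[OF \<sigma>(1)] by auto
      then show ?thesis
        using closed_simplex_subset[OF \<sigma>(1)]
        by (auto simp: open_simplex_def closed_simplex_def realization_points_def)
    qed
    ultimately show ?thesis
      using \<sigma> finite_complex by (intro exI[of _ ?F]) (auto simp: E_def dm_def)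
  qed
  have "CW_structure ?X E dm (\<lambda>e. \<phi> (carrier e))"
    unfolding CW_structure_def
    by (intro conjI ballI allI impI haus cover \<open>disjoint E\<close> boundary closedin_iff_closure_pieces[OF finE cover]
        maps[THEN conjunct1] maps[THEN conjunct2])
  moreover have "dm e \<le> d" if e: "e \<in> E" for e
  proof -
    obtain \<sigma> where "\<sigma> \<in> K" "carrier e = \<sigma>"
      using E_cases[OF e] by auto
    then show ?thesis
      using dim[of \<sigma>] by (simp add: dm_def)
  qed
  ultimately show ?thesis
    unfolding CW_complex_dim_le_def by blast
qed

end

section \<open>Relabelling the vertices\<close>

lemma supp_comp:
  assumes "bij f" shows "supp (x \<circ> inv f) = f ` supp x"
proof (intro equalityI subsetI)
  fix w assume "w \<in> supp (x \<circ> inv f)"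
  then have "inv f w \<in> supp x" "f (inv f w) = w"
    using assms by (auto simp: supp_def bij_is_surj surj_f_inv_f)
  then show "w \<in> f ` supp x"
    by (metis imageI)
qed (use assms in \<open>auto simp: supp_def bij_is_inj inv_f_f\<close>)

lemma continuous_on_precompose:
  fixes h :: "'b \<Rightarrow> 'a" and S :: "('a \<Rightarrow> 'c::topological_space) set"
  shows "continuous_on S (\<lambda>x. x \<circ> h)"
  by (rule continuous_on_coordinatewise_then_product)
     (auto intro: continuous_on_subset[OF continuous_on_product_coordinates])

lemma realization_points_relabel:
  assumes "bij f" "x \<in> realization_points K"
  shows "x \<circ> inv f \<in> realization_points ((`) f ` K)"
proof -
  have "sum (x \<circ> inv f) (f ` supp x) = sum x (supp x)"
    using assms(1) by (subst sum.reindex) (auto simp: bij_is_inj inj_on_subset[OF bij_is_inj])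
  then show ?thesis
    using assms by (auto simp: realization_points_def supp_comp)
qed

text \<open>The CW-complex has to live on \<open>nat \<Rightarrow> real\<close>, whereas the
  vertices of the core are lists; this moves it there.\<close>

lemma geometric_realization_relabel:
  assumes "bij f"
  shows "geometric_realization K homeomorphic_space geometric_realization ((`) f ` K)"
proof -
  have inv: "inv (inv f) = f" "bij (inv f)"
    using assms by (auto simp: inv_inv_eq bij_imp_bij_inv)
  have K: "(`) (inv f) ` (`) f ` K = K"
    using assms by (auto simp: image_comp bij_is_inj image_image)
  have "y \<circ> f \<in> realization_points K" if "y \<in> realization_points ((`) f ` K)" for y
    using realization_points_relabel[OF inv(2) that] by (simp add: inv K)
  then have "homeomorphic_maps (geometric_realization K) (geometric_realization ((`) f ` K))
      (\<lambda>x. x \<circ> inv f) (\<lambda>y. y \<circ> f)"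
    unfolding homeomorphic_maps_def geometric_realization_eq
    using assms realization_points_relabel[OF assms]
    by (auto simp: continuous_on_precompose comp_assoc bij_is_inj surj_iff[THEN iffD1] bij_is_surj)
  then show ?thesis
    unfolding homeomorphic_space_def by blast
qed

lemma finite_complex_relabel:
  assumes "finite_complex K"
  shows "finite_complex ((`) f ` K)"
proof -
  interpret finite_complex K by fact
  show ?thesis
  proof
    fix \<sigma> \<tau> assume "\<sigma> \<in> (`) f ` K" "\<tau> \<subseteq> \<sigma>" "\<tau> \<noteq> {}"
    then obtain \<rho> where "\<rho> \<in> K" "\<tau> \<subseteq> f ` \<rho>" by auto
    moreover from this obtain \<rho>' where "\<rho>' \<subseteq> \<rho>" "\<tau> = f ` \<rho>'"
      by (meson subset_image_iff)
    ultimately show "\<tau> \<in> (`) f ` K"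
      using face_closed[of \<rho> \<rho>'] \<open>\<tau> \<noteq> {}\<close> by auto
  qed (use finite_complex finite_simplex simplex_nonempty in auto)
qed

section \<open>Multisets that differ by an exchange\<close>

text \<open>This allows \<open>p = q\<close>, so equal multisets are near.\<close>

definition near :: "'a multiset \<Rightarrow> 'a multiset \<Rightarrow> bool" where
  "near A B \<longleftrightarrow> (\<exists>p q. add_mset p B = add_mset q A)"

lemma near_refl [simp]: "near A A"
  by (auto simp: near_def)

lemma near_sym: "near A B \<Longrightarrow> near B A"
  unfolding near_def by metis

lemma near_common_sub: "near (add_mset s N) (add_mset t N)"
  unfolding near_def by (metis add_mset_commute)

lemma near_common_super: "add_mset s A = add_mset t B \<Longrightarrow> near A B"
  unfolding near_def by metis

text \<open>Write \<open>A = N + p\<close> and \<open>B = N + q\<close>. Comparing \<open>C\<close>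
  with both leaves two cases: \<open>p = s\<close>, where \<open>C\<close> also extends
  \<open>N\<close>, and \<open>p = v\<close>, where \<open>C\<close> is \<open>N + p + q\<close>
  less one element.\<close>

lemma near_triangle:
  assumes "near A B" "near A C" "near B C" "A \<noteq> B" "A \<noteq> C" "B \<noteq> C"
  shows "(\<exists>N p q r. A = add_mset p N \<and> B = add_mset q N \<and> C = add_mset r N) \<or>
    (\<exists>M p q r. add_mset p A = M \<and> add_mset q B = M \<and> add_mset r C = M)"
proof -
  obtain p q where pq: "add_mset p B = add_mset q A"
    using assms(1) unfolding near_def by blast
  then have "p \<noteq> q"
    using assms(4) by auto
  with pq obtain N where A: "A = add_mset p N" and B: "B = add_mset q N"
    by (auto simp: add_eq_conv_ex)
  obtain s t where st: "add_mset s C = add_mset t (add_mset p N)"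
    using assms(2) A unfolding near_def by blast
  obtain u v where uv: "add_mset u C = add_mset v (add_mset q N)"
    using assms(3) B unfolding near_def by blast
  \<comment> \<open>Adding both \<open>s\<close> and \<open>u\<close> to \<open>C\<close> lets the
    two descriptions of \<open>C\<close> be compared after cancelling \<open>N\<close>.\<close>
  have "N + {#p, t, u#} = add_mset u (add_mset s C)"
    using st by simp
  also have "\<dots> = N + {#q, v, s#}"
    using uv by (simp add: add_mset_commute)
  finally have eq: "{#p, t, u#} = {#q, v, s#}"
    by (metis add_left_cancel)
  have "s \<noteq> t" "u \<noteq> v"
    using st uv assms(5,6) A B by auto
  have "p \<in># {#q, v, s#}"
    unfolding eq[symmetric] by simp
  then consider "p = s" | "p = v"
    using \<open>p \<noteq> q\<close> by auto
  then show ?thesis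
  proof cases
    case 1
    then have "C = add_mset t N"
      using st by (simp add: add_mset_commute)
    with A B show ?thesis by blast
  next
    case 2
    then have "{#t, u#} = {#q, s#}"
      using eq by (simp add: add_mset_commute)
    then have "t = q"
      using \<open>s \<noteq> t\<close> by (auto simp: add_eq_conv_ex)
    then have "add_mset s C = add_mset q A"
      using st A by simp
    with pq show ?thesis by metis
  qed
qed

text \<open>Pigeonhole: \<open>p\<close>, \<open>q\<close> and \<open>r\<close> all occur in the
  two-element multiset \<open>{#p, t#}\<close>.\<close>

lemma not_three_distinct_in_pair:
  assumes "add_mset p {#t#} = add_mset q {#t'#}" "add_mset p {#t#} = add_mset r {#t''#}"
  shows "p = q \<or> p = r \<or> q = r"
  using assms by (auto simp: add_eq_conv_ex)

text \<open>If \<open>X\<close> had too few copies of some \<open>z\<close>, then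
  \<open>X + z\<close> would be \<open>N\<close> plus a pair containing each of \<open>p\<close>,
  \<open>q\<close>, \<open>r\<close>, which is impossible. So \<open>X\<close> contains
  \<open>N\<close>, and comparing sizes leaves one further element.\<close>

lemma near_star:
  assumes "p \<noteq> q" "p \<noteq> r" "q \<noteq> r"
    and "near (add_mset p N) X" "near (add_mset q N) X" "near (add_mset r N) X"
  shows "\<exists>s. X = add_mset s N"
proof -
  have exch: "\<exists>s t. add_mset s X = add_mset t (add_mset p N)" if "near (add_mset p N) X" for p
    using that unfolding near_def by blast
  have "N \<subseteq># X"
  proof (rule ccontr)
    assume "\<not> N \<subseteq># X"
    then obtain z where z: "count X z < count N z"
      by (auto simp: subseteq_mset_def not_le)
    have key: "\<exists>t. add_mset z X = N + {#p, t#}" if n: "near (add_mset p N) X" for p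
    proof -
      obtain s t where st: "add_mset s X = add_mset t (add_mset p N)"
        using exch[OF n] by blast
      \<comment> \<open>Only the inserted \<open>s\<close> can make up the deficit of
        \<open>z\<close> in \<open>X\<close>.\<close>
      from arg_cong[OF st, of "\<lambda>M. count M z"] z have "s = z"
        by (auto split: if_splits)
      with st show ?thesis by (auto simp: add_mset_commute)
    qed
    obtain t1 t2 t3 where "add_mset z X = N + {#p, t1#}" "add_mset z X = N + {#q, t2#}"
        "add_mset z X = N + {#r, t3#}"
      using key[OF assms(4)] key[OF assms(5)] key[OF assms(6)] by blast
    then have "{#p, t1#} = {#q, t2#}" "{#p, t1#} = {#r, t3#}"
      by (metis add_left_cancel)+
    with not_three_distinct_in_pair assms(1-3) show False by metis
  qed
  then obtain R where R: "X = N + R"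
    by (auto simp: mset_subset_eq_exists_conv)
  moreover obtain s t where "add_mset s X = add_mset t (add_mset p N)"
    using exch[OF assms(4)] by blast
  ultimately have "size R = 1"
    by (metis Suc_inject add_left_cancel plus_1_eq_Suc add.commute size_add_mset size_union)
  then obtain s where "R = {#s#}"
    using size_1_singleton_mset by blast
  with R show ?thesis by auto
qed

text \<open>The dual of \<open>near_star\<close>: a surplus \<open>z\<close> of \<open>X\<close>
  over \<open>M\<close> would make \<open>M + z\<close> equal to \<open>X\<close> plus a pair
  containing each of \<open>p\<close>, \<open>q\<close>, \<open>r\<close>.\<close>

lemma near_costar:
  assumes "p \<noteq> q" "p \<noteq> r" "q \<noteq> r"
    and M: "add_mset p A = M" "add_mset q B = M" "add_mset r C = M"
    and "near A X" "near B X" "near C X"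
  shows "\<exists>s. add_mset s X = M"
proof -
  have exch: "\<exists>s t. add_mset s (add_mset p X) = add_mset t M" if "near A X" "add_mset p A = M" for p A
    using that unfolding near_def by (metis add_mset_commute)
  have "X \<subseteq># M"
  proof (rule ccontr)
    assume "\<not> X \<subseteq># M"
    then obtain z where z: "count M z < count X z"
      by (auto simp: subseteq_mset_def not_le)
    have key: "\<exists>t. X + {#p, t#} = add_mset z M" if n: "near A X" "add_mset p A = M" for p A
    proof -
      obtain s t where st: "add_mset s (add_mset p X) = add_mset t M"
        using exch[OF n] by blast
      from arg_cong[OF st, of "\<lambda>M. count M z"] z have "t = z"
        by (auto split: if_splits)
      with st show ?thesis by (auto simp: add_mset_commute)
    qed
    obtain t1 t2 t3 where "X + {#p, t1#} = add_mset z M" "X + {#q, t2#} = add_mset z M"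
        "X + {#r, t3#} = add_mset z M"
      using key[OF assms(7) M(1)] key[OF assms(8) M(2)] key[OF assms(9) M(3)] by blast
    then have "{#p, t1#} = {#q, t2#}" "{#p, t1#} = {#r, t3#}"
      by (metis add_left_cancel)+
    with not_three_distinct_in_pair assms(1-3) show False by metis
  qed
  then obtain R where R: "M = X + R"
    by (auto simp: mset_subset_eq_exists_conv)
  moreover obtain s t where "add_mset s (add_mset p X) = add_mset t M"
    using exch[OF assms(7) M(1)] by blast
  ultimately have "size R = 1"
    by (metis Suc_inject add_left_cancel plus_1_eq_Suc add.commute size_add_mset size_union)
  then obtain s where "R = {#s#}"
    using size_1_singleton_mset by blast
  with R show ?thesis by auto
qed

text \<open>As \<open>near\<close> is reflexive, \<open>X\<close> and \<open>Y\<close> may be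
  vertices of the triangle itself, which spares the gluing argument a case distinction.\<close>

lemma near_of_near_triangle:
  assumes "near A B" "near A C" "near B C" and ne: "A \<noteq> B" "A \<noteq> C" "B \<noteq> C"
    and X: "near A X" "near B X" "near C X" and Y: "near A Y" "near B Y" "near C Y"
  shows "near X Y"
  using near_triangle[OF assms(1-6)]
proof (elim disjE exE conjE)
  fix N p q r assume N: "A = add_mset p N" "B = add_mset q N" "C = add_mset r N"
  with ne have "p \<noteq> q" "p \<noteq> r" "q \<noteq> r" by auto
  note star = near_star[OF this, of N]
  show ?thesis
    using star[of X] star[of Y] X Y N near_common_sub by metis
next
  fix M p q r assume M: "add_mset p A = M" "add_mset q B = M" "add_mset r C = M"
  with ne have "p \<noteq> q" "p \<noteq> r" "q \<noteq> r"
    by (metis add_mset_add_mset_same_iff)+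
  note costar = near_costar[OF this M]
  show ?thesis
    using costar[of X] costar[of Y] X Y near_common_super by metis
qed

section \<open>The partition complex\<close>

text \<open>The column indices of the cells of the diagram. This does not depend on the order of the rows,
  so the sorting in \<^const>\<open>move_cell\<close> has no effect on it.\<close>

definition cells :: "nat list \<Rightarrow> nat multiset" where
  "cells xs = (\<Sum>r\<leftarrow>xs. mset [0..<r])"

section \<open>The effect of a cell move on the column multiset\<close>

lemma count_upt: "count (mset [0..<r]) k = of_bool (k < r)"
  by (induction r) auto

text \<open>These counts are the column lengths, so for a partition the multiset encodes the
  conjugate partition.\<close>

lemma count_cells: "count (cells xs) k = length (filter (\<lambda>r. k < r) xs)"
  unfolding cells_def by (induction xs) (auto simp: count_upt simp del: mset_upt)

text \<open>Stated additively to avoid the truncated subtraction of multisets.\<close>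

lemma cells_update:
  "i < length xs \<Longrightarrow> cells (xs[i := v]) + mset [0..<xs ! i] = cells xs + mset [0..<v]"
  unfolding cells_def
proof (induction xs arbitrary: i)
  case (Cons a xs)
  then show ?case
    by (cases i) (auto simp: algebra_simps simp del: mset_upt)
qed simp

lemma cells_increment:
  assumes "i < length xs" shows "cells (xs[i := xs ! i + 1]) = add_mset (xs ! i) (cells xs)"
  using cells_update[OF assms, of "xs ! i + 1"] by (simp add: union_assoc del: mset_upt)

lemma cells_decrement:
  assumes "i < length xs" "xs ! i \<noteq> 0" shows "add_mset (xs ! i - 1) (cells (xs[i := xs ! i - 1])) = cells xs"
  using cells_increment[of i "xs[i := xs ! i - 1]"] assms by (simp add: list_update_same_conv)

lemma cells_normalize: "cells (rev (sort (filter (\<lambda>r. 0 < r) xs))) = cells xs"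
proof (rule multiset_eqI)
  fix k
  have "filter (\<lambda>r. k < r) (filter (\<lambda>r. 0 < r) xs) = filter (\<lambda>r. k < r) xs"
    by (auto intro: filter_cong)
  then show "count (cells (rev (sort (filter (\<lambda>r. 0 < r) xs)))) k = count (cells xs) k"
    by (simp add: count_cells filter_sort flip: rev_filter)
qed

text \<open>With columns numbered from 0, the last cell of a row of length \<open>r\<close> has
  index \<open>r - 1\<close> and a cell appended to it gets index \<open>r\<close>. Since
  \<open>i \<noteq> j\<close>, the removal does not affect the length of row
  \<open>j\<close>.\<close>

lemma cells_move:
  assumes "\<forall>x\<in>set xs. 0 < x" "i < length xs" "j \<le> length xs" "i \<noteq> j"
  shows "add_mset (xs ! i - 1) (cells (move_cell xs i j)) = add_mset ((xs @ [0]) ! j) (cells xs)"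
proof -
  define zs where "zs = (xs @ [0])[i := xs ! i - 1]"
  have "move_cell xs i j = rev (sort (filter (\<lambda>r. 0 < r) (zs[j := zs ! j + 1])))"
    using assms by (simp add: move_cell_def Let_def zs_def nth_append)
  then have "cells (move_cell xs i j) = add_mset ((xs @ [0]) ! j) (cells zs)"
    using assms cells_increment[of j zs] by (simp add: cells_normalize zs_def)
  moreover have "add_mset (xs ! i - 1) (cells zs) = cells xs"
    using assms cells_decrement[of i "xs @ [0]"] nth_mem[of i xs] by (simp add: zs_def nth_append cells_def)
  ultimately show ?thesis
    by (metis add_mset_commute)
qed

section \<open>Recovering partitions and cell moves from multisets\<close>

definition decreasing :: "nat list \<Rightarrow> bool" where
  "decreasing xs \<longleftrightarrow> sorted_wrt (\<ge>) xs \<and> (\<forall>x\<in>set xs. 0 < x)"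

lemma decreasing_move_cell: "decreasing (move_cell xs i j)"
  by (auto simp: decreasing_def move_cell_def Let_def sorted_wrt_rev)

text \<open>A row longer than \<open>k\<close> either has length \<open>k + 1\<close> or is longer
  than \<open>k + 1\<close>.\<close>

lemma count_mset_Suc: "count (mset xs) (Suc k) + count (cells xs) (Suc k) = count (cells xs) k"
  by (induction xs) (auto simp: count_cells)

text \<open>Differences of neighbouring column lengths count the rows of each positive length, and
  the order of the rows is fixed.\<close>

lemma cells_inject:
  assumes "decreasing xs" "decreasing ys" "cells xs = cells ys"
  shows "xs = ys"
proof -
  have "count (mset xs) k = count (mset ys) k" for k
  proof (cases k)
    case 0
    have "count (mset zs) 0 = 0" if "decreasing zs" for zs
      using that unfolding decreasing_def by (metis less_irrefl not_in_iff set_mset_mset)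
    then show ?thesis
      using assms(1,2) 0 by metis
  next
    case (Suc m)
    then show ?thesis
      using count_mset_Suc[of xs m] count_mset_Suc[of ys m] assms(3) by simp
  qed
  then have "mset (rev xs) = mset (rev ys)"
    by (simp add: multiset_eq_iff)
  moreover have "sorted (rev xs)" "sorted (rev ys)"
    using assms by (auto simp: decreasing_def sorted_wrt_rev)
  ultimately show ?thesis
    by (metis properties_for_sort rev_rev_ident)
qed

text \<open>A drop between neighbouring columns marks the end of a row.\<close>

lemma row_of_count_less:
  assumes "count (cells xs) (Suc k) < count (cells xs) k"
  obtains i where "i < length xs" "xs ! i = Suc k"
proof -
  have "count (mset xs) (Suc k) \<noteq> 0"
    using assms count_mset_Suc[of xs k] by linarith
  then have "Suc k \<in> set xs"
    by (metis not_in_iff set_mset_mset)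
  then show ?thesis
    using that by (auto simp: in_set_conv_nth)
qed

lemma count_cells_antimono: "count (cells xs) (Suc k) \<le> count (cells xs) k"
  using count_mset_Suc[of xs k] by simp

text \<open>Since \<open>ys\<close> exists, \<open>p\<close> is the column of a removable corner of
  \<open>xs\<close>, and after its removal a cell can be added in column \<open>q\<close>. This
  determines the two rows of the move.\<close>

lemma cell_moveI:
  assumes "decreasing xs" "decreasing ys" "p \<noteq> q"
    and eq: "add_mset p (cells ys) = add_mset q (cells xs)"
  shows "cell_move xs ys"
proof -
  note cnt = arg_cong[OF eq, of "\<lambda>M. count M k" for k]
  \<comment> \<open>Column \<open>p\<close> of \<open>xs\<close> is one cell longer than that of
    \<open>ys\<close>, while column \<open>p + 1\<close> is no longer than that of
    \<open>ys\<close>.\<close>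
  have "count (cells xs) (Suc p) < count (cells xs) p"
    using cnt[of p] cnt[of "Suc p"] count_cells_antimono[of ys p] \<open>p \<noteq> q\<close> by (auto split: if_splits)
  then obtain i where i: "i < length xs" "xs ! i = Suc p"
    by (rule row_of_count_less)
  define zs where "zs = xs[i := p]"
  have "add_mset p (cells zs) = cells xs"
    using cells_decrement[of i xs] i by (simp add: zs_def)
  with eq have zs: "cells ys = add_mset q (cells zs)"
    by (metis add_mset_add_mset_same_iff add_mset_commute)
  have "\<exists>j\<le>length xs. i \<noteq> j \<and> (xs @ [0]) ! j = q"
  proof (cases q)
    case 0
    \<comment> \<open>A new cell in column 0 opens a new row, represented by the appended 0.\<close>
    then show ?thesis
      using i by (intro exI[of _ "length xs"]) auto
  next
    case (Suc m)
    \<comment> \<open>The row is sought in \<open>zs\<close>, where row \<open>i\<close> has length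
      \<open>p \<noteq> q\<close>; so the row found differs from \<open>i\<close> and has the same
      length in \<open>xs\<close>.\<close>
    have "count (cells zs) (Suc m) < count (cells zs) m"
      using count_cells_antimono[of ys m] Suc by (simp add: zs)
    then obtain j where "j < length zs" "zs ! j = Suc m"
      by (rule row_of_count_less)
    then show ?thesis
      using Suc \<open>p \<noteq> q\<close> i by (intro exI[of _ j]) (auto simp: zs_def nth_append nth_list_update split: if_splits)
  qed
  then obtain j where j: "j \<le> length xs" "i \<noteq> j" "(xs @ [0]) ! j = q"
    by auto
  have "add_mset p (cells (move_cell xs i j)) = add_mset p (cells ys)"
    using cells_move[of xs i j] i j assms(1) eq by (simp add: decreasing_def)
  then have "ys = move_cell xs i j"
    using cells_inject[OF assms(2) decreasing_move_cell] by simp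
  with i j show ?thesis
    unfolding cell_move_def by blast
qed

lemma partition_adj_iff:
  assumes "xs \<in> partitions n" "ys \<in> partitions n"
  shows "partition_adj xs ys \<longleftrightarrow> xs \<noteq> ys \<and> near (cells xs) (cells ys)"
proof -
  have dec: "decreasing xs" "decreasing ys"
    using assms by (auto simp: partitions_def decreasing_def)
  have "near (cells us) (cells vs)" if "cell_move us vs" "decreasing us" for us vs
    using that cells_move[of us] unfolding cell_move_def near_def decreasing_def by metis
  then have "partition_adj xs ys \<Longrightarrow> xs \<noteq> ys \<and> near (cells xs) (cells ys)"
    using dec near_sym unfolding partition_adj_def by blast
  moreover have "partition_adj xs ys" if ne: "xs \<noteq> ys" and nr: "near (cells xs) (cells ys)"
  proof -
    obtain p q where pq: "add_mset p (cells ys) = add_mset q (cells xs)"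
      using nr unfolding near_def by blast
    moreover from this have "p \<noteq> q"
      using ne cells_inject[OF dec] by auto
    ultimately show ?thesis
      using cell_moveI[OF dec] ne by (simp add: partition_adj_def)
  qed
  ultimately show ?thesis by blast
qed

section \<open>Gluing cliques of partitions\<close>

lemma finite_partitions: "finite (partitions n)"
proof (rule finite_subset)
  show "partitions n \<subseteq> {xs. set xs \<subseteq> {..n} \<and> length xs \<le> n}"
  proof
    fix xs assume xs: "xs \<in> partitions n"
    have "length xs \<le> sum_list xs" if "\<forall>x\<in>set xs. 0 < x" for xs :: "nat list"
      using that by (induction xs) auto
    then show "xs \<in> {xs. set xs \<subseteq> {..n} \<and> length xs \<le> n}"
      using xs by (auto simp: partitions_def intro: member_le_sum_list)
  qed
qed (rule finite_lists_length_le, simp)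

lemma finite_complex_clique_complex: "finite V \<Longrightarrow> finite_complex (clique_complex V adj)"
proof
  assume "finite V"
  then show "finite (clique_complex V adj)"
    by (rule finite_subset[rotated, OF finite_Pow_iff[THEN iffD2]]) (auto simp: clique_complex_def)
qed (auto simp: clique_complex_def intro: finite_subset)

text \<open>Every vertex of \<open>\<sigma> \<union> \<tau>\<close> is near to three common vertices
  \<open>a\<close>, \<open>b\<close>, \<open>c\<close>, so any two such vertices are near to each
  other.\<close>

lemma triangle_rigid_partition_complex: "triangle_rigid_complex (partition_complex n)"
  unfolding partition_complex_def
proof (intro triangle_rigid_complex.intro triangle_rigid_complex_axioms.intro
    finite_complex_clique_complex finite_partitions)
  let ?K = "clique_complex (partitions n) partition_adj"
  fix \<sigma> \<tau> assume \<sigma>\<tau>: "\<sigma> \<in> ?K" "\<tau> \<in> ?K" "3 \<le> card (\<sigma> \<inter> \<tau>)"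
  have sub: "\<sigma> \<union> \<tau> \<subseteq> partitions n" and fin: "finite \<sigma>" "finite \<tau>"
    using \<sigma>\<tau> by (auto simp: clique_complex_def)
  have near: "near (cells x) (cells y)" if "\<rho> \<in> {\<sigma>, \<tau>}" "x \<in> \<rho>" "y \<in> \<rho>" for \<rho> x y
  proof (cases "x = y")
    case False
    then have "partition_adj x y"
      using that \<sigma>\<tau> by (auto simp: clique_complex_def)
    then show ?thesis
      using partition_adj_iff[of x n y] sub that by auto
  qed simp
  obtain a b c where abc: "{a, b, c} \<subseteq> \<sigma> \<inter> \<tau>" "a \<noteq> b" "a \<noteq> c" "b \<noteq> c"
    using \<sigma>\<tau>(3) fin by (subst (asm) three_le_card_iff) auto
  have inj: "cells x \<noteq> cells y" if "x \<noteq> y" "x \<in> partitions n" "y \<in> partitions n" for x y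
    using that cells_inject[of x y] by (auto simp: partitions_def decreasing_def)
  have "near (cells x) (cells y)" if "x \<in> \<sigma> \<union> \<tau>" "y \<in> \<sigma> \<union> \<tau>" for x y
  proof (rule near_of_near_triangle)
    show "cells a \<noteq> cells b" "cells a \<noteq> cells c" "cells b \<noteq> cells c"
      using inj[of a b] inj[of a c] inj[of b c] abc sub by blast+
  qed (use near[of \<sigma>] near[of \<tau>] abc that in auto)
  then have "partition_adj x y" if "x \<in> \<sigma> \<union> \<tau>" "y \<in> \<sigma> \<union> \<tau>" "x \<noteq> y" for x y
    using that partition_adj_iff[of x n y] sub by blast
  moreover have "\<sigma> \<union> \<tau> \<noteq> {}"
    using abc by blast
  ultimately show "\<sigma> \<union> \<tau> \<in> ?K"
    using sub fin unfolding clique_complex_def by blast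
qed

theorem corollary5p17:
  fixes n :: nat
  assumes "n \<ge> 1"
  shows "has_homotopy_type_of_CW_dim_le (geometric_realization (partition_complex n)) 2"
proof -
  interpret triangle_rigid_complex "partition_complex n"
    by (rule triangle_rigid_partition_complex)
  \<comment> \<open>The bijection \<open>list_encode\<close> turns partitions into natural numbers,
    so the realization of \<open>?L\<close> has the point type required of the CW-complex.\<close>
  let ?L = "(`) list_encode ` core"
  have "CW_complex_dim_le 2 (geometric_realization ?L)"
  proof (rule finite_complex.CW_complex_realization)
    show "finite_complex ?L"
      by (intro finite_complex_relabel finite_complex_core)
    show "card \<sigma> \<le> Suc 2" if "\<sigma> \<in> ?L" for \<sigma>
      using that card_core by (auto simp: card_image inj_list_encode)
  qed
  moreover have "geometric_realization (partition_complex n) homotopy_equivalent_space geometric_realization ?L"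
    by (rule homotopy_eqv_trans[OF realization_homotopy_equivalent_core
          homeomorphic_imp_homotopy_equivalent_space[OF geometric_realization_relabel[OF bij_list_encode]]])
  ultimately show ?thesis
    unfolding has_homotopy_type_of_CW_dim_le_def by blast
qed

end
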